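(* Fix constants $d \in \mathbb{N}$, $\tau \in (2,3)$ and $\lambda > 0$, and let $G \sim \mathcal{G}(n, [0,1]^d, \tau, \lambda)$ be a threshold GIRG. Then $G$ has a connected component of size $\Theta(n)$ with probability $1 - \exp\left(-\Omega\left(n^{(3-\tau)/2}\right)\right)$.
   Context: Threshold GIRG $\mathcal{G}(n, [0,1]^d, \tau, \lambda)$: the vertex set is a homogeneous Poisson point process on $[0,1]^d$ with intensity $n$ (so the number of vertices in a region of volume $a$ is Poisson with mean $an$, independently for disjoint regions). Each vertex $v$ independently receives a weight $w_v > 1$ with $\Pr[w_v \le w] = 1 - w^{-(\tau-1)}$ for $w \ge 1$. Two vertices $u,v$ are adjacent if and only if $\|u-v\|_\infty \le (\lambda w_u w_v / n)^{1/d}$, where $\|\cdot\|_\infty$ is the $L_\infty$ distance. The parameters $d,\tau,\lambda$ are constants and asymptotic notation refers to $n \to \infty$. *)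

theory Defs
  imports "HOL-Probability.Probability"
begin

text \<open>
  A random finite collection of points is given by a random number \<open>N\<close> together with positions
  \<open>X 0, X 1, \<dots>\<close>, of which only \<open>X i\<close> with \<open>i < N\<close> are points of the process.  The enumeration is
  arbitrary: in particular, the positions are not assumed to be independent or uniform.
\<close>

definition point_count :: "('w \<Rightarrow> nat) \<Rightarrow> (nat \<Rightarrow> 'w \<Rightarrow> 'a) \<Rightarrow> 'a set \<Rightarrow> 'w \<Rightarrow> nat" where
  "point_count N X A \<omega> = card {i. i < N \<omega> \<and> X i \<omega> \<in> A}"

text \<open>
  The Poisson probabilities are written out because \<open>poisson_pmf\<close> is only specified for a
  positive rate, whereas regions of volume \<open>0\<close> have to be covered here.
\<close>

locale homogeneous_ppp = prob_space M
  for M :: "'w measure" and N :: "'w \<Rightarrow> nat" and X :: "nat \<Rightarrow> 'w \<Rightarrow> 'a::euclidean_space"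
    and S :: "'a set" and r :: real +
  assumes number_measurable: "random_variable (count_space UNIV) N"
    and position_measurable: "\<And>i. random_variable borel (X i)"
    and position_in: "\<And>\<omega> i. \<omega> \<in> space M \<Longrightarrow> i < N \<omega> \<Longrightarrow> X i \<omega> \<in> S"
    and count_poisson: "\<And>A k. A \<in> sets borel \<Longrightarrow> A \<subseteq> S \<Longrightarrow>
      prob {\<omega> \<in> space M. point_count N X A \<omega> = k} =
        (r * measure lborel A) ^ k / fact k * exp (- (r * measure lborel A))"
    and count_indep: "\<And>A :: nat \<Rightarrow> 'a set.
      (\<And>j. A j \<in> sets borel) \<Longrightarrow> (\<And>j. A j \<subseteq> S) \<Longrightarrow> disjoint_family A \<Longrightarrow>
      indep_vars (\<lambda>_. count_space UNIV) (\<lambda>j. point_count N X (A j)) UNIV"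

text \<open>
  Vertex \<open>i < N\<close> has position \<open>X i\<close> and weight \<open>W i\<close>.  The weights are i.i.d. and, as a family,
  independent of the whole point process.
\<close>

locale threshold_girg = homogeneous_ppp M N X "cbox 0 1" n
  for M :: "'w measure" and N :: "'w \<Rightarrow> nat" and X :: "nat \<Rightarrow> 'w \<Rightarrow> real ^ 'd"
    and n :: real +
  fixes W :: "nat \<Rightarrow> 'w \<Rightarrow> real" and \<tau> :: real
  assumes intensity_pos: "0 < n"
    and weight_gt_1: "\<And>i \<omega>. \<omega> \<in> space M \<Longrightarrow> 1 < W i \<omega>"
    and weight_cdf: "\<And>i w. 1 \<le> w \<Longrightarrow>
      prob {\<omega> \<in> space M. W i \<omega> \<le> w} = 1 - w powr (- (\<tau> - 1))"
    and weight_indep: "indep_vars (\<lambda>_. borel) W UNIV"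
    and weight_indep_points:
      "indep_set
        (sets (vimage_algebra (space M) (\<lambda>\<omega>. (N \<omega>, \<lambda>i. X i \<omega>))
                 (count_space UNIV \<Otimes>\<^sub>M (\<Pi>\<^sub>M i\<in>UNIV. borel))))
        (sets (vimage_algebra (space M) (\<lambda>\<omega> i. W i \<omega>) (\<Pi>\<^sub>M i\<in>UNIV. borel)))"

definition girg_verts :: "('w \<Rightarrow> nat) \<Rightarrow> 'w \<Rightarrow> nat set" where
  "girg_verts N \<omega> = {i. i < N \<omega>}"

text \<open>The library's \<open>infnorm\<close> is the \<open>L\<^sub>\<infinity>\<close> norm.\<close>

definition girg_edges ::
  "('w \<Rightarrow> nat) \<Rightarrow> (nat \<Rightarrow> 'w \<Rightarrow> real ^ 'd) \<Rightarrow> real \<Rightarrow> (nat \<Rightarrow> 'w \<Rightarrow> real) \<Rightarrow> real \<Rightarrow> 'w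
    \<Rightarrow> (nat \<times> nat) set" where
  "girg_edges N X n W lam \<omega> =
    {(u, v). u \<in> girg_verts N \<omega> \<and> v \<in> girg_verts N \<omega> \<and> u \<noteq> v \<and>
       infnorm (X u \<omega> - X v \<omega>) \<le> (lam * W u \<omega> * W v \<omega> / n) powr (1 / real CARD('d))}"

text \<open>For a symmetric edge relation \<open>E \<subseteq> V \<times> V\<close>: the vertex sets of the connected components.\<close>

definition graph_components :: "'v set \<Rightarrow> ('v \<times> 'v) set \<Rightarrow> 'v set set" where
  "graph_components V E = V // {(u, v). u \<in> V \<and> v \<in> V \<and> (u, v) \<in> E\<^sup>*}"

end

theory Submission
  imports Defs "HOL-Real_Asymp.Real_Asymp"
begin

text \<open>
  Write \<open>\<kappa> = (3 - \<tau>) / 2\<close> and split the cube into \<open>2 ^ (j d)\<close> dyadic cells at every depth \<open>j \<le> J\<close>,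
  where the cells of depth \<open>J\<close> contain a large constant number of vertices on average. Let
  \<open>\<mu> j = n / 2 ^ (j d)\<close> and call a vertex heavy at depth \<open>j\<close> if its weight exceeds
  \<open>sqrt (2 ^ d \<mu> j / lam)\<close>. Two vertices in a common cell of depth \<open>j\<close>, one heavy at depth \<open>j\<close> and
  the other at depth \<open>j\<close> or \<open>j + 1\<close>, are adjacent. Hence all cells of depth \<open>J\<close> whose ancestors
  (including themselves) all contain a heavy vertex contribute distinct vertices to one component.

  By Poisson thinning, \<open>t\<close> given cells of depth \<open>j\<close> all lack a heavy vertex with probability
  \<open>exp (- c t (\<mu> j) ^ \<kappa>)\<close>. A union bound over all sets of cells shows that at most a fraction \<open>e j\<close>
  of the cells of depth \<open>j\<close> is bad, where \<open>e j\<close> is proportional to \<open>\<rho> ^ j + \<rho> ^ (J - j)\<close> with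
  \<open>\<rho> = 2 ^ (- d \<kappa>)\<close>. The second summand makes \<open>e j (\<mu> j) ^ \<kappa>\<close> large enough to beat the number of
  sets of cells; the first one makes the exponent at least of order \<open>n ^ \<kappa>\<close>, because
  \<open>2 ^ d \<rho>\<^sup>2 \<ge> 1\<close>. The fractions add up to at most \<open>1/2\<close>, so half of the cells of depth \<open>J\<close> survive.
\<close>

subsection \<open>Dyadic cells\<close>

text \<open>Describing the half-open cells by floors makes each point lie in exactly one cell of
  each depth and turns the passage to an ancestor into integer division of the index. Points with a
  coordinate equal to 1 lie in no cell indexed by \<open>dyadic_indices\<close>; only vertices
  inside such cells are counted later.\<close>

definition dyadic_cell :: "nat \<Rightarrow> ('d::finite \<Rightarrow> int) \<Rightarrow> (real ^ 'd) set" where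
  "dyadic_cell j k = {x. \<forall>i. \<lfloor>2 ^ j * x $ i\<rfloor> = k i}"

definition dyadic_indices :: "nat \<Rightarrow> ('d::finite \<Rightarrow> int) set" where
  "dyadic_indices j = (UNIV \<rightarrow>\<^sub>E {0..<2 ^ j})"

lemma dyadic_indices_iff: "k \<in> dyadic_indices j \<longleftrightarrow> (\<forall>i. 0 \<le> k i \<and> k i < 2 ^ j)"
  by (auto simp: dyadic_indices_def PiE_iff)

lemma finite_dyadic_indices [simp]: "finite (dyadic_indices j)"
  by (simp add: dyadic_indices_def finite_PiE)

lemma card_dyadic_indices:
  "card (dyadic_indices j :: ('d::finite \<Rightarrow> int) set) = 2 ^ (j * CARD('d))"
  by (simp add: dyadic_indices_def card_PiE power_mult nat_power_eq)

lemma dyadic_cell_measurable [measurable]: "dyadic_cell j k \<in> sets borel"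
proof -
  have "{x \<in> space borel. \<forall>i. \<lfloor>2 ^ j * (x :: real ^ 'a) $ i\<rfloor> = k i} \<in> sets borel"
    by measurable
  then show ?thesis by (simp add: dyadic_cell_def)
qed

lemma dyadic_cell_iff:
  "x \<in> dyadic_cell j k \<longleftrightarrow> (\<forall>i. of_int (k i) / 2 ^ j \<le> x $ i \<and> x $ i < (of_int (k i) + 1) / 2 ^ j)"
  by (simp add: dyadic_cell_def floor_eq_iff field_simps)

lemma dyadic_cell_disjoint: "k \<noteq> l \<Longrightarrow> dyadic_cell j k \<inter> dyadic_cell j l = {}"
  by (auto simp: dyadic_cell_def)

lemma dyadic_cell_subset_cbox:
  assumes "k \<in> dyadic_indices j"
  shows "dyadic_cell j k \<subseteq> cbox 0 1"
proof
  fix x assume x: "x \<in> dyadic_cell j k"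
  have "0 \<le> x $ i \<and> x $ i \<le> 1" for i
  proof -
    have k: "0 \<le> k i" "k i + 1 \<le> 2 ^ j" using assms by (auto simp: dyadic_indices_iff add1_zle_eq)
    have "real_of_int (k i + 1) \<le> real_of_int (2 ^ j)" using k(2) by (rule of_int_le_iff[THEN iffD2])
    hence "(of_int (k i) + 1) / 2 ^ j \<le> (1::real)" by (simp add: field_simps)
    moreover have "of_int (k i) / 2 ^ j \<ge> (0::real)" using k by simp
    ultimately show ?thesis using x[unfolded dyadic_cell_iff, rule_format, of i] by linarith
  qed
  then show "x \<in> cbox 0 1" by (simp add: mem_box_cart)
qed

text \<open>Dividing by a positive integer and then flooring gives the same as flooring first and
  dividing with \<open>div\<close>.\<close>

lemma dyadic_cell_ancestor:
  assumes "x \<in> dyadic_cell (j + m) k"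
  shows "x \<in> dyadic_cell j (\<lambda>i. k i div 2 ^ m)"
proof -
  have "\<lfloor>2 ^ j * x $ i\<rfloor> = k i div 2 ^ m" for i
  proof -
    have "\<lfloor>2 ^ j * x $ i\<rfloor> = \<lfloor>(2 ^ (j + m) * x $ i) / of_int (2 ^ m)\<rfloor>"
      by (simp add: power_add)
    also have "\<dots> = \<lfloor>2 ^ (j + m) * x $ i\<rfloor> div 2 ^ m"
      by (rule floor_divide_real_eq_div) simp
    finally show ?thesis using assms by (simp add: dyadic_cell_def)
  qed
  then show ?thesis by (simp add: dyadic_cell_def)
qed

lemma infnorm_diff_dyadic_cell:
  assumes "x \<in> dyadic_cell j k" "y \<in> dyadic_cell j k"
  shows "infnorm (x - y) \<le> 1 / 2 ^ j"
proof -
  have "\<bar>(x - y) $ i\<bar> \<le> 1 / 2 ^ j" for i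
  proof -
    have "of_int (k i) / 2 ^ j \<le> x $ i" "x $ i < of_int (k i) / 2 ^ j + 1 / 2 ^ j"
      "of_int (k i) / 2 ^ j \<le> y $ i" "y $ i < of_int (k i) / 2 ^ j + 1 / 2 ^ j"
      using assms by (auto simp: dyadic_cell_iff add_divide_distrib)
    then show ?thesis by simp
  qed
  then show ?thesis
    unfolding infnorm_cart by (intro cSup_least) auto
qed

text \<open>The cell contains the open box with the same corners, whose volume is known. A lower
  bound is the useful direction, since volumes enter through void probabilities, which decrease in
  the volume.\<close>

lemma measure_dyadic_cell_ge:
  "(1 / 2 ^ j) ^ CARD('d) \<le> measure lborel (dyadic_cell j (k :: 'd::finite \<Rightarrow> int))"
proof -
  define a :: "real ^ 'd" where "a = (\<chi> i. of_int (k i) / 2 ^ j)"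
  define b :: "real ^ 'd" where "b = (\<chi> i. (of_int (k i) + 1) / 2 ^ j)"
  have ba: "(b - a) \<bullet> e = 1 / 2 ^ j" if "e \<in> Basis" for e
    using that by (auto simp: Basis_vec_def a_def b_def inner_axis field_simps)
  have "a \<bullet> e \<le> b \<bullet> e" if "e \<in> Basis" for e
  proof -
    have "0 \<le> (b - a) \<bullet> e" using ba[OF that] by simp
    then show ?thesis by (simp add: inner_diff_left)
  qed
  hence "measure lborel (box a b) = (\<Prod>e\<in>Basis. (b - a) \<bullet> e)"
    by (subst measure_lborel_box_eq) auto
  also have "\<dots> = (1 / 2 ^ j) ^ CARD('d)"
    using ba by simp
  finally have "(1 / 2 ^ j) ^ CARD('d) = measure lborel (box a b)" ..
  also have "\<dots> \<le> measure lborel (dyadic_cell j k)"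
  proof (rule measure_mono_fmeasurable)
    show "box a b \<subseteq> dyadic_cell j k"
      by (auto simp: mem_box_cart dyadic_cell_iff a_def b_def less_imp_le)
    have "dyadic_cell j k \<subseteq> cbox a b"
      by (auto simp: mem_box_cart dyadic_cell_iff a_def b_def less_imp_le)
    then show "dyadic_cell j k \<in> fmeasurable lborel"
      by (rule fmeasurableI2[OF fmeasurable_cbox]) simp
  qed simp
  finally show ?thesis .
qed

lemma measure_Union_dyadic_cell_ge:
  fixes T :: "('d::finite \<Rightarrow> int) set"
  assumes "T \<subseteq> dyadic_indices j"
  shows "real (card T) * (1 / 2 ^ j) ^ CARD('d) \<le> measure lborel (\<Union>k\<in>T. dyadic_cell j k)"
proof -
  have fin: "finite T" using assms finite_dyadic_indices by (rule finite_subset)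
  have "real (card T) * (1 / 2 ^ j) ^ CARD('d) \<le> (\<Sum>k\<in>T. measure lborel (dyadic_cell j k))"
    using measure_dyadic_cell_ge by (intro sum_bounded_below)
  also have "\<dots> = measure lborel (\<Union>k\<in>T. dyadic_cell j k)"
  proof (rule measure_finite_Union[symmetric])
    show "disjoint_family_on (dyadic_cell j) T"
      using dyadic_cell_disjoint by (auto simp: disjoint_family_on_def)
    show "emeasure lborel (dyadic_cell j k) \<noteq> \<infinity>" if "k \<in> T" for k
    proof -
      have "emeasure lborel (dyadic_cell j k) \<le> emeasure lborel (cbox 0 (1 :: real ^ 'd))"
        using that assms dyadic_cell_subset_cbox by (intro emeasure_mono) auto
      also have "\<dots> < \<infinity>" by (rule emeasure_lborel_cbox_finite)
      finally show ?thesis by simp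
    qed
  qed (use fin in auto)
  finally show ?thesis .
qed

text \<open>Each coordinate of a descendant lies in a block of \<open>2 ^ m\<close> consecutive
  integers. This bounds how many of the deepest cells a single light cell can spoil.\<close>

lemma card_dyadic_descendants:
  fixes l :: "'d::finite \<Rightarrow> int"
  shows "card {k \<in> dyadic_indices J. (\<lambda>i. k i div 2 ^ m) = l} \<le> 2 ^ (m * CARD('d))"
proof -
  let ?P = "PiE UNIV (\<lambda>i. {l i * 2 ^ m..<(l i + 1) * 2 ^ m})"
  have "{k \<in> dyadic_indices J. (\<lambda>i. k i div 2 ^ m) = l} \<subseteq> ?P"
  proof
    fix k assume "k \<in> {k \<in> dyadic_indices J. (\<lambda>i. k i div 2 ^ m) = l}"
    hence "l i = k i div 2 ^ m" for i by auto
    moreover have "a div 2 ^ m * 2 ^ m \<le> a" "a < (a div 2 ^ m + 1) * 2 ^ m" for a :: int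
      using div_mult_mod_eq[of a "2 ^ m"] pos_mod_sign[of "2 ^ m" a, OF zero_less_power]
        pos_mod_bound[of "2 ^ m" a, OF zero_less_power]
      unfolding distrib_right by linarith+
    ultimately show "k \<in> ?P" by auto
  qed
  hence "card {k \<in> dyadic_indices J. (\<lambda>i. k i div 2 ^ m) = l} \<le> card ?P"
    by (intro card_mono finite_PiE) auto
  also have "\<dots> = 2 ^ (m * CARD('d))"
    by (simp add: card_PiE power_mult algebra_simps nat_power_eq)
  finally show ?thesis .
qed

lemma dyadic_index_ancestor:
  assumes "k \<in> dyadic_indices (j + m)"
  shows "(\<lambda>i. k i div 2 ^ m) \<in> dyadic_indices j"
proof -
  have "a div 2 ^ m < 2 ^ j" if "a < 2 ^ j * 2 ^ m" for a :: int
  proof (rule ccontr)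
    assume "\<not> a div 2 ^ m < 2 ^ j"
    hence "2 ^ j * 2 ^ m \<le> a div 2 ^ m * 2 ^ m" by (intro mult_right_mono) auto
    also have "\<dots> \<le> a"
      using div_mult_mod_eq[of a "2 ^ m"] pos_mod_sign[of "2 ^ m" a, OF zero_less_power] by linarith
    finally show False using that by simp
  qed
  then show ?thesis
    using assms by (auto simp: dyadic_indices_iff power_add pos_imp_zdiv_nonneg_iff)
qed

subsection \<open>Void probabilities and measurability\<close>

lemma (in prob_space) prob_sums_nat_valued:
  fixes Y :: "'a \<Rightarrow> nat"
  assumes "E \<in> events" "Y \<in> measurable M (count_space UNIV)"
  shows "(\<lambda>k. prob (E \<inter> {\<omega> \<in> space M. Y \<omega> = k})) sums prob E"
proof -
  have "(\<lambda>k. prob (E \<inter> {\<omega> \<in> space M. Y \<omega> = k})) sums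
      prob (\<Union>k. E \<inter> {\<omega> \<in> space M. Y \<omega> = k})"
    using assms by (intro finite_measure_UNION) (auto simp: disjoint_family_on_def)
  also have "(\<Union>k. E \<inter> {\<omega> \<in> space M. Y \<omega> = k}) = E"
    using sets.sets_into_space[OF assms(1)] by auto
  finally show ?thesis .
qed

text \<open>The enumeration of the points may depend on their positions. Fixing the whole index set,
  not just its size, determines which weights matter, so that independence of weights and points can
  be applied.\<close>

definition point_set :: "('w \<Rightarrow> nat) \<Rightarrow> (nat \<Rightarrow> 'w \<Rightarrow> 'a) \<Rightarrow> 'a set \<Rightarrow> 'w \<Rightarrow> nat set" where
  "point_set N X A \<omega> = {i. i < N \<omega> \<and> X i \<omega> \<in> A}"

lemma finite_point_set [simp]: "finite (point_set N X A \<omega>)"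
  by (simp add: point_set_def)

lemma point_count_eq_card: "point_count N X A \<omega> = card (point_set N X A \<omega>)"
  by (simp add: point_count_def point_set_def)

context threshold_girg
begin

lemma weight_measurable [measurable]: "random_variable borel (W i)"
  using weight_indep by (auto simp: indep_vars_def)

lemmas [measurable] = number_measurable position_measurable

lemma prob_weights_le:
  assumes "finite F" "1 \<le> w"
  shows "prob {\<omega> \<in> space M. \<forall>i\<in>F. W i \<omega> \<le> w} = (1 - w powr (- (\<tau> - 1))) ^ card F"
proof (cases "F = {}")
  case True
  then show ?thesis by (simp add: prob_space)
next
  case False
  have "prob (\<Inter>i\<in>F. W i -` {..w} \<inter> space M) = (\<Prod>i\<in>F. prob (W i -` {..w} \<inter> space M))"
    using assms False by (intro indep_varsD[OF weight_indep]) auto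
  moreover have "W i -` {..w} \<inter> space M = {\<omega> \<in> space M. W i \<omega> \<le> w}" for i by auto
  moreover have "(\<Inter>i\<in>F. W i -` {..w} \<inter> space M) = {\<omega> \<in> space M. \<forall>i\<in>F. W i \<omega> \<le> w}"
    using False by auto
  ultimately show ?thesis using assms by (simp add: weight_cdf)
qed

text \<open>For a fixed \<open>F\<close> the first condition depends only on \<open>N\<close> and
  \<open>X\<close>, the second only on \<open>W\<close>. Both are shown to lie in the two generated
  sigma-algebras of \<open>weight_indep_points\<close>.\<close>

lemma prob_points_and_weights_le:
  assumes A [measurable]: "A \<in> sets borel" and "finite F" "1 \<le> w"
  shows "prob {\<omega> \<in> space M. point_set N X A \<omega> = F \<and> (\<forall>i\<in>F. W i \<omega> \<le> w)} =
    prob {\<omega> \<in> space M. point_set N X A \<omega> = F} * (1 - w powr (- (\<tau> - 1))) ^ card F"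
proof -
  let ?P = "count_space UNIV \<Otimes>\<^sub>M (\<Pi>\<^sub>M i\<in>UNIV. borel) :: (nat \<times> (nat \<Rightarrow> real ^ 'd)) measure"
  let ?U = "{p \<in> space ?P. \<forall>i. (i < fst p \<and> snd p i \<in> A) = (i \<in> F)}"
  let ?Q = "(\<Pi>\<^sub>M i\<in>UNIV. borel) :: (nat \<Rightarrow> real) measure"
  let ?V = "{x \<in> space ?Q. \<forall>i\<in>F. x i \<le> w}"
  have "?U \<in> sets ?P" by measurable
  from in_vimage_algebra[OF this, of "\<lambda>\<omega>. (N \<omega>, \<lambda>i. X i \<omega>)" "space M"]
  have 1: "{\<omega> \<in> space M. point_set N X A \<omega> = F}
      \<in> sets (vimage_algebra (space M) (\<lambda>\<omega>. (N \<omega>, \<lambda>i. X i \<omega>)) ?P)"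
    by (rule back_subst[of "\<lambda>S. S \<in> _"]) (auto simp: space_pair_measure space_PiM point_set_def)
  have "?V \<in> sets ?Q" using \<open>finite F\<close> by measurable
  from in_vimage_algebra[OF this, of "\<lambda>\<omega> i. W i \<omega>" "space M"]
  have 2: "{\<omega> \<in> space M. \<forall>i\<in>F. W i \<omega> \<le> w}
      \<in> sets (vimage_algebra (space M) (\<lambda>\<omega> i. W i \<omega>) ?Q)"
    by (rule back_subst[of "\<lambda>S. S \<in> _"]) (auto simp: space_PiM)
  have "{\<omega> \<in> space M. point_set N X A \<omega> = F \<and> (\<forall>i\<in>F. W i \<omega> \<le> w)} =
      {\<omega> \<in> space M. point_set N X A \<omega> = F} \<inter> {\<omega> \<in> space M. \<forall>i\<in>F. W i \<omega> \<le> w}"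
    by auto
  then show ?thesis
    using indep_setD[OF weight_indep_points 1 2] prob_weights_le[OF assms(2,3)] by simp
qed

lemma point_set_event [measurable]:
  assumes [measurable]: "A \<in> sets borel"
  shows "{\<omega> \<in> space M. point_set N X A \<omega> = F} \<in> events"
proof -
  have "{\<omega> \<in> space M. \<forall>i. (i < N \<omega> \<and> X i \<omega> \<in> A) = (i \<in> F)} \<in> events" by measurable
  then show ?thesis
    by (rule back_subst[of "\<lambda>S. S \<in> _"]) (auto simp: point_set_def)
qed

lemma light_event [measurable]:
  assumes [measurable]: "A \<in> sets borel"
  shows "{\<omega> \<in> space M. \<forall>i<N \<omega>. X i \<omega> \<in> A \<longrightarrow> W i \<omega> \<le> w} \<in> events"
proof -
  have "{\<omega> \<in> space M. \<forall>i. i < N \<omega> \<longrightarrow> X i \<omega> \<in> A \<longrightarrow> W i \<omega> \<le> w} \<in> events" by measurable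
  then show ?thesis by (rule back_subst[of "\<lambda>S. S \<in> _"]) auto
qed

text \<open>There are only countably many finite index sets, and they give disjoint events. Working
  with \<open>emeasure\<close> avoids summability conditions.\<close>

lemma emeasure_decompose_point_set:
  assumes A [measurable]: "A \<in> sets borel" and E [measurable]: "E \<in> events"
  shows "emeasure M (E \<inter> {\<omega> \<in> space M. point_count N X A \<omega> = k}) =
    (\<integral>\<^sup>+F. emeasure M (E \<inter> {\<omega> \<in> space M. point_set N X A \<omega> = F})
      \<partial>count_space {F. finite F \<and> card F = k})"
proof -
  have "E \<inter> {\<omega> \<in> space M. point_count N X A \<omega> = k} =
    (\<Union>F\<in>{F. finite F \<and> card F = k}. E \<inter> {\<omega> \<in> space M. point_set N X A \<omega> = F})"
    unfolding point_count_eq_card using finite_point_set[of N X A] by blast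
  also have "emeasure M \<dots> =
    (\<integral>\<^sup>+F. emeasure M (E \<inter> {\<omega> \<in> space M. point_set N X A \<omega> = F})
      \<partial>count_space {F. finite F \<and> card F = k})"
  proof (rule emeasure_UN_countable)
    show "countable {F :: nat set. finite F \<and> card F = k}"
      by (rule countable_subset[OF _ countable_Collect_finite]) blast
  qed (auto simp: disjoint_family_on_def)
  finally show ?thesis .
qed

lemma point_count_measurable [measurable]:
  assumes [measurable]: "A \<in> sets borel"
  shows "point_count N X A \<in> measurable M (count_space UNIV)"
proof -
  have "{\<omega> \<in> space M. point_count N X A \<omega> = k} \<in> events" for k
  proof -
    have "{\<omega> \<in> space M. point_count N X A \<omega> = k} =
        (\<Union>F\<in>{F. finite F \<and> card F = k}. {\<omega> \<in> space M. point_set N X A \<omega> = F})"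
      unfolding point_count_eq_card using finite_point_set[of N X A] by blast
    also have "\<dots> \<in> events"
      by (intro sets.countable_UN' image_subsetI point_set_event assms
          countable_subset[OF _ countable_Collect_finite]) blast
    finally show ?thesis .
  qed
  then show ?thesis
    by (intro measurable_count_space_eq2_countable[THEN iffD2])
      (auto simp: vimage_def Int_def conj_commute)
qed

text \<open>Thinning: the points of \<open>A\<close> with weight above \<open>w\<close> again form a Poisson process, and
  this is its void probability.\<close>

lemma prob_no_heavy_point:
  assumes A [measurable]: "A \<in> sets borel" and "A \<subseteq> cbox 0 1" and w: "1 \<le> w"
  shows "prob {\<omega> \<in> space M. \<forall>i<N \<omega>. X i \<omega> \<in> A \<longrightarrow> W i \<omega> \<le> w} =
    exp (- (n * measure lborel A * w powr (- (\<tau> - 1))))" (is "prob ?E = _")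
proof -
  define p where "p = 1 - w powr (- (\<tau> - 1))"
  \<comment> \<open>\<open>p\<close> is the probability that a vertex weight is at most
    \<open>w\<close>; index 0 is an arbitrary choice.\<close>
  have p: "0 \<le> p" using w weight_cdf[OF w, of 0] by (metis p_def measure_nonneg)
  define v where "v = n * measure lborel A"
  have E [measurable]: "?E \<in> events" by (rule light_event) fact
  have k: "prob (?E \<inter> {\<omega> \<in> space M. point_count N X A \<omega> = k}) = exp (- v) * ((v * p) ^ k /\<^sub>R fact k)" for k
  proof -
    let ?I = "\<lambda>F. {\<omega> \<in> space M. point_set N X A \<omega> = F}"
    \<comment> \<open>The factor \<open>p ^ k\<close> depends only on the size of \<open>F\<close>,
      so it can be pulled out of the sum over all \<open>F\<close> of size \<open>k\<close>; what
      remains recombines into the Poisson probability of \<open>k\<close> points in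
      \<open>A\<close>.\<close>
    have "emeasure M (?E \<inter> ?I F) = ennreal (p ^ k) * emeasure M (space M \<inter> ?I F)"
      if F: "finite F" "card F = k" for F
    proof -
      have "?E \<inter> ?I F = {\<omega> \<in> space M. point_set N X A \<omega> = F \<and> (\<forall>i\<in>F. W i \<omega> \<le> w)}"
        by (auto simp: point_set_def)
      moreover have "space M \<inter> ?I F = ?I F" by auto
      ultimately show ?thesis
        using prob_points_and_weights_le[OF A F(1) w, folded p_def] F(2) p
        by (simp add: emeasure_eq_measure ennreal_mult mult.commute)
    qed
    hence "emeasure M (?E \<inter> {\<omega> \<in> space M. point_count N X A \<omega> = k}) =
      (\<integral>\<^sup>+F. ennreal (p ^ k) * emeasure M (space M \<inter> ?I F) \<partial>count_space {F. finite F \<and> card F = k})"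
      unfolding emeasure_decompose_point_set[OF A E] by (intro nn_integral_cong) auto
    also have "\<dots> = ennreal (p ^ k) * emeasure M (space M \<inter> {\<omega> \<in> space M. point_count N X A \<omega> = k})"
      by (subst emeasure_decompose_point_set[OF A]) (auto simp: nn_integral_cmult)
    also have "space M \<inter> {\<omega> \<in> space M. point_count N X A \<omega> = k} =
        {\<omega> \<in> space M. point_count N X A \<omega> = k}" by auto
    finally have "prob (?E \<inter> {\<omega> \<in> space M. point_count N X A \<omega> = k}) =
        p ^ k * prob {\<omega> \<in> space M. point_count N X A \<omega> = k}"
      using p by (simp add: emeasure_eq_measure ennreal_mult'[symmetric])
    then show ?thesis
      unfolding count_poisson[OF A \<open>A \<subseteq> cbox 0 1\<close>]
      by (simp add: v_def divide_inverse power_mult_distrib)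
  qed
  \<comment> \<open>Summing over the number of points gives an exponential series, with value
    \<open>exp (- (v * (1 - p)))\<close>.\<close>
  have "(\<lambda>k. exp (- v) * ((v * p) ^ k /\<^sub>R fact k)) sums (exp (- v) * exp (v * p))"
    by (intro sums_mult exp_converges)
  moreover have "(\<lambda>k. exp (- v) * ((v * p) ^ k /\<^sub>R fact k)) sums prob ?E"
    using prob_sums_nat_valued[OF E point_count_measurable[OF A]] unfolding k .
  ultimately have "prob ?E = exp (- v) * exp (v * p)"
    by (rule sums_unique2[rotated])
  also have "\<dots> = exp (- (v * w powr (- (\<tau> - 1))))"
    by (simp add: exp_add[symmetric] p_def algebra_simps)
  finally show ?thesis by (simp add: v_def)
qed

text \<open>A Chernoff bound with parameter 1: on the event, \<open>exp (N - 3 * n)\<close> exceeds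
  1, and its Poisson expectation is \<open>exp ((exp 1 - 4) * n)\<close>; finally
  \<open>exp 1 \<le> 3\<close>. It limits the component size from above.\<close>

lemma prob_number_gt:
  "prob {\<omega> \<in> space M. 3 * n < real (N \<omega>)} \<le> exp (- n)"
proof -
  let ?E = "{\<omega> \<in> space M. 3 * n < real (N \<omega>)}"
  have E: "?E \<in> events" by measurable
  have "measure lborel (cbox 0 1 :: (real ^ 'd) set) = 1"
    by (simp add: content_cbox_if_cart interval_ne_empty_cart)
  moreover have "point_count N X (cbox 0 1) \<omega> = N \<omega>" if "\<omega> \<in> space M" for \<omega>
  proof -
    have "{i. i < N \<omega> \<and> X i \<omega> \<in> cbox 0 1} = {..<N \<omega>}" using position_in[OF that] by auto
    then show ?thesis by (simp add: point_count_def)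
  qed
  ultimately have pois: "prob {\<omega> \<in> space M. N \<omega> = k} = n ^ k / fact k * exp (- n)" for k
    using count_poisson[of "cbox 0 1" k] by (simp cong: conj_cong)
  have "prob (?E \<inter> {\<omega> \<in> space M. N \<omega> = k}) \<le> exp (- (4 * n)) * ((exp 1 * n) ^ k /\<^sub>R fact k)" for k
  proof (cases "3 * n < real k")
    case True
    have "prob (?E \<inter> {\<omega> \<in> space M. N \<omega> = k}) \<le> prob {\<omega> \<in> space M. N \<omega> = k}"
      by (intro finite_measure_mono) auto
    also have "\<dots> = 1 * (n ^ k / fact k * exp (- n))" using pois by simp
    also have "\<dots> \<le> exp (real k - 3 * n) * (n ^ k / fact k * exp (- n))"
      using True intensity_pos by (intro mult_right_mono) auto
    also have "\<dots> = (exp (real k - 3 * n) * exp (- n)) * (n ^ k / fact k)"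
      by (simp only: mult_ac)
    also have "exp (real k - 3 * n) * exp (- n) = exp (- (4 * n)) * exp (real k)"
      by (simp flip: exp_add)
    also have "\<dots> * (n ^ k / fact k) = exp (- (4 * n)) * (exp (real k) * n ^ k / fact k)"
      by simp
    also have "exp (real k) = exp 1 ^ k" by (simp flip: exp_of_nat_mult)
    finally show ?thesis by (simp add: power_mult_distrib divide_inverse mult.commute)
  next
    case False
    hence "?E \<inter> {\<omega> \<in> space M. N \<omega> = k} = {}" by auto
    then show ?thesis using intensity_pos by simp
  qed
  moreover have "(\<lambda>k. exp (- (4 * n)) * ((exp 1 * n) ^ k /\<^sub>R fact k)) sums
      (exp (- (4 * n)) * exp (exp 1 * n))"
    by (intro sums_mult exp_converges)
  ultimately have "prob ?E \<le> exp (- (4 * n)) * exp (exp 1 * n)"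
    by (rule sums_le[OF _ prob_sums_nat_valued[OF E number_measurable]])
  also have "\<dots> \<le> exp (- n)"
    using mult_right_mono[OF exp_le, of n] intensity_pos by (simp flip: exp_add)
  finally show ?thesis .
qed

section \<open>Measurability of graph properties\<close>

lemma girg_edges_event:
  "{\<omega> \<in> space M. N \<omega> = k \<and> girg_edges N X n W lam \<omega> = E} \<in> events"
proof (cases "E \<subseteq> {..<k} \<times> {..<k}")
  case True
  have [measurable]: "(\<lambda>\<omega>. infnorm (X u \<omega> - X v \<omega>)) \<in> borel_measurable M" for u v
    by (rule measurable_compose[OF _ borel_measurable_continuous_onI[of infnorm]])
      (auto intro: continuous_intros)
  have "{\<omega> \<in> space M. N \<omega> = k \<and> (\<forall>u\<in>{..<k}. \<forall>v\<in>{..<k}. ((u, v) \<in> E) =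
      (u \<noteq> v \<and> infnorm (X u \<omega> - X v \<omega>) \<le> (lam * W u \<omega> * W v \<omega> / n) powr (1 / real CARD('d))))}
    \<in> events"
    by measurable
  also have "{\<omega> \<in> space M. N \<omega> = k \<and> (\<forall>u\<in>{..<k}. \<forall>v\<in>{..<k}. ((u, v) \<in> E) =
      (u \<noteq> v \<and> infnorm (X u \<omega> - X v \<omega>) \<le> (lam * W u \<omega> * W v \<omega> / n) powr (1 / real CARD('d))))} =
    {\<omega> \<in> space M. N \<omega> = k \<and> girg_edges N X n W lam \<omega> = E}"
    (is "{\<omega> \<in> _. _ \<and> ?Q \<omega>} = _")
  proof (intro Collect_cong conj_cong refl)
    fix \<omega> assume "N \<omega> = k"
    then show "?Q \<omega> \<longleftrightarrow> girg_edges N X n W lam \<omega> = E"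
      using True unfolding girg_edges_def girg_verts_def by blast
  qed
  finally show ?thesis .
next
  case False
  hence "{\<omega> \<in> space M. N \<omega> = k \<and> girg_edges N X n W lam \<omega> = E} = {}"
    by (auto simp: girg_edges_def girg_verts_def)
  then show ?thesis by (metis sets.empty_sets)
qed

text \<open>The random graph takes only countably many values, since its vertex set is an initial
  segment and its edge set is finite. Hence every property \<open>P\<close>, however complicated,
  defines an event.\<close>

lemma girg_property_event:
  "{\<omega> \<in> space M. P (girg_verts N \<omega>) (girg_edges N X n W lam \<omega>)} \<in> events"
proof -
  have "finite (girg_edges N X n W lam \<omega>)" for \<omega>
    by (rule finite_subset[of _ "{..<N \<omega>} \<times> {..<N \<omega>}"]) (auto simp: girg_edges_def girg_verts_def)
  hence "{\<omega> \<in> space M. P (girg_verts N \<omega>) (girg_edges N X n W lam \<omega>)} =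
    (\<Union>k. \<Union>E\<in>{E. finite E \<and> P {..<k} E}. {\<omega> \<in> space M. N \<omega> = k \<and> girg_edges N X n W lam \<omega> = E})"
    unfolding girg_verts_def lessThan_def by blast
  also have "\<dots> \<in> events"
    by (intro sets.countable_UN sets.countable_UN' girg_edges_event image_subsetI
        countable_subset[OF _ countable_Collect_finite]) blast
  finally show ?thesis .
qed

end

subsection \<open>The component of the heavy vertices\<close>

definition light_cells ::
  "('w \<Rightarrow> nat) \<Rightarrow> (nat \<Rightarrow> 'w \<Rightarrow> real ^ 'd) \<Rightarrow> (nat \<Rightarrow> 'w \<Rightarrow> real) \<Rightarrow> real \<Rightarrow> nat \<Rightarrow> 'w
    \<Rightarrow> ('d \<Rightarrow> int) set" where
  "light_cells N X W w j \<omega> =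
    {k \<in> dyadic_indices j. \<forall>i<N \<omega>. X i \<omega> \<in> dyadic_cell j k \<longrightarrow> W i \<omega> \<le> w}"

text \<open>The connection radius is at least the side length of the cell. Two separate thresholds
  \<open>a\<close> and \<open>b\<close> allow endpoints that are heavy at different depths.\<close>

lemma girg_edge_same_cell:
  fixes X :: "nat \<Rightarrow> 'w \<Rightarrow> real ^ 'd"
  assumes "u < N \<omega>" "v < N \<omega>" "u \<noteq> v" "0 < n" "0 < lam" "0 \<le> a" "0 \<le> b"
    and "X u \<omega> \<in> dyadic_cell j k" "X v \<omega> \<in> dyadic_cell j k" "a \<le> W u \<omega>" "b \<le> W v \<omega>"
    and ab: "n * (1 / 2 ^ j) ^ CARD('d) \<le> lam * a * b"
  shows "(u, v) \<in> girg_edges N X n W lam \<omega>"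
proof -
  have "infnorm (X u \<omega> - X v \<omega>) \<le> 1 / 2 ^ j"
    using assms by (intro infnorm_diff_dyadic_cell)
  \<comment> \<open>The side length is the \<open>d\<close>-th root of the cell volume, which
    matches the form of the radius.\<close>
  also have "\<dots> = ((1 / 2 ^ j) ^ CARD('d)) powr (1 / real CARD('d))"
    by (simp add: powr_powr flip: powr_realpow)
  also have "\<dots> \<le> (lam * W u \<omega> * W v \<omega> / n) powr (1 / real CARD('d))"
  proof (intro powr_mono2)
    have "lam * a * b \<le> lam * W u \<omega> * W v \<omega>"
      using assms by (intro mult_mono) auto
    with ab have "(1 / 2 ^ j) ^ CARD('d) * n \<le> lam * W u \<omega> * W v \<omega>"
      by (simp only: mult.commute)
    then show "(1 / 2 ^ j) ^ CARD('d) \<le> lam * W u \<omega> * W v \<omega> / n"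
      using \<open>0 < n\<close> by (simp only: pos_le_divide_eq)
  qed auto
  finally show ?thesis using assms by (simp add: girg_edges_def girg_verts_def)
qed

text \<open>A deterministic statement about one outcome. The sum bounds the number of deepest cells
  with a light ancestor; each remaining cell supplies one vertex linked to the root by a chain of
  heavy vertices. Assumption \<open>few\<close> ensures that such a cell, and hence a heavy root
  vertex, exists.\<close>

lemma component_through_heavy_cells:
  fixes X :: "nat \<Rightarrow> 'w \<Rightarrow> real ^ 'd" and w :: "nat \<Rightarrow> real"
  assumes n: "0 < n" and lam: "0 < lam" and w: "\<And>j. 0 \<le> w j"
    and ww: "\<And>j. n * (1 / 2 ^ j) ^ CARD('d) \<le> lam * w j * w j"
    and ww': "\<And>j. n * (1 / 2 ^ j) ^ CARD('d) \<le> lam * w j * w (Suc j)"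
    and few: "(\<Sum>j\<le>J. card (light_cells N X W (w j) j \<omega>) * 2 ^ ((J - j) * CARD('d))) < 2 ^ (J * CARD('d))"
  shows "\<exists>K\<in>graph_components (girg_verts N \<omega>) (girg_edges N X n W lam \<omega>).
    2 ^ (J * CARD('d)) \<le> card K +
      (\<Sum>j\<le>J. card (light_cells N X W (w j) j \<omega>) * 2 ^ ((J - j) * CARD('d)))"
proof -
  define B where "B j = light_cells N X W (w j) j \<omega>" for j
  define anc :: "nat \<Rightarrow> ('d \<Rightarrow> int) \<Rightarrow> 'd \<Rightarrow> int" where "anc j k = (\<lambda>i. k i div 2 ^ (J - j))" for j k
  define heavy where "heavy j k v \<longleftrightarrow> v < N \<omega> \<and> X v \<omega> \<in> dyadic_cell j k \<and> w j < W v \<omega>" for j k v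
  define good where "good = {k \<in> dyadic_indices J. \<forall>j\<le>J. anc j k \<notin> B j}"
  define S where "S = (\<Sum>j\<le>J. card (B j) * 2 ^ ((J - j) * CARD('d)))"
  let ?V = "girg_verts N \<omega>" and ?E = "girg_edges N X n W lam \<omega>"
  have finB: "finite (B j)" for j
    unfolding B_def light_cells_def by simp

  have "dyadic_indices J - good \<subseteq> (\<Union>j\<le>J. \<Union>l\<in>B j. {k \<in> dyadic_indices J. anc j k = l})"
    by (auto simp: good_def)
  hence "card (dyadic_indices J - good) \<le> card (\<Union>j\<le>J. \<Union>l\<in>B j. {k \<in> dyadic_indices J. anc j k = l})"
    using finB by (intro card_mono) auto
  also have "\<dots> \<le> (\<Sum>j\<le>J. card (\<Union>l\<in>B j. {k \<in> dyadic_indices J. anc j k = l}))"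
    by (rule card_UN_le) simp
  also have "\<dots> \<le> (\<Sum>j\<le>J. \<Sum>l\<in>B j. card {k \<in> dyadic_indices J. anc j k = l})"
    using finB by (intro sum_mono card_UN_le)
  also have "\<dots> \<le> (\<Sum>j\<le>J. \<Sum>l\<in>B j. 2 ^ ((J - j) * CARD('d)))"
    unfolding anc_def by (intro sum_mono card_dyadic_descendants)
  also have "\<dots> = S" by (simp add: S_def)
  finally have "card (dyadic_indices J :: ('d \<Rightarrow> int) set) - card good \<le> S"
    using card_Diff_subset[of good "dyadic_indices J"]
    by (simp add: good_def finite_subset[of _ "dyadic_indices J"])
  hence good: "2 ^ (J * CARD('d)) \<le> card good + S"
    by (simp add: card_dyadic_indices)
  have S_less: "S < 2 ^ (J * CARD('d))" using few by (simp add: S_def B_def)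
  have "good \<noteq> {}" using good S_less by auto

  have ex_heavy: "\<exists>v. heavy j (anc j k) v" if "k \<in> good" "j \<le> J" for j k
  proof -
    have "anc j k \<in> dyadic_indices j"
      using that dyadic_index_ancestor[of k j "J - j"] by (simp add: good_def anc_def)
    moreover have "anc j k \<notin> B j" using that by (simp add: good_def)
    ultimately show ?thesis by (auto simp: B_def light_cells_def heavy_def not_le)
  qed
  have anc_0: "anc 0 k = (\<lambda>_. 0)" if "k \<in> good" for k
    using that by (auto simp: good_def anc_def dyadic_indices_iff)
  \<comment> \<open>All cells of depth \<open>J\<close> share the ancestor of depth 0, so a single
    vertex \<open>r\<close> serves as common root.\<close>
  obtain r where r: "heavy 0 (\<lambda>_. 0) r"
    using \<open>good \<noteq> {}\<close> ex_heavy anc_0 by (metis all_not_in_conv le0)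
  \<comment> \<open>Reachability is stated instead of adjacency because one vertex may be heavy at
    both depths, and then \<open>u = v\<close>.\<close>
  have adj: "(u, v) \<in> ?E\<^sup>*"
    if "heavy j k u" "heavy j' k' v" "X v \<omega> \<in> dyadic_cell j k" "j' = j \<or> j' = Suc j" for j j' k k' u v
  proof (cases "u = v")
    case False
    have "(u, v) \<in> ?E"
      using that False n lam w ww[of j] ww'[of j]
      by (intro girg_edge_same_cell[of u N \<omega> v n lam "w j" "w j'" X j k])
        (auto simp: heavy_def less_imp_le)
    then show ?thesis by auto
  qed auto
  have conn: "(r, v) \<in> ?E\<^sup>*" if k: "k \<in> good" and "j \<le> J" "heavy j (anc j k) v" for j k v
    using that(2,3)
  proof (induction j arbitrary: v)
    case 0
    then show ?case using adj[OF r, of 0 _ v] anc_0[OF k] by (auto simp: heavy_def)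
  next
    case (Suc j)
    obtain u where u: "heavy j (anc j k) u" using ex_heavy[OF k, of j] Suc by auto
    have "J - j = Suc (J - Suc j)" using Suc by simp
    \<comment> \<open>The ancestor at depth \<open>j\<close> is the parent of the one at depth
      \<open>j + 1\<close>, so \<open>v\<close> also lies in the cell that contains
      \<open>u\<close>.\<close>
    hence "anc j k = (\<lambda>i. anc (Suc j) k i div 2 ^ 1)"
      by (simp add: anc_def fun_eq_iff zdiv_zmult2_eq mult.commute[of 2])
    hence "X v \<omega> \<in> dyadic_cell j (anc j k)"
      using Suc.prems dyadic_cell_ancestor[of "X v \<omega>" j 1 "anc (Suc j) k"] by (simp add: heavy_def)
    with Suc.IH[OF _ u] adj[OF u Suc.prems(2)] Suc.prems show ?case by auto
  qed

  define R where "R = {(u, v). u \<in> ?V \<and> v \<in> ?V \<and> (u, v) \<in> ?E\<^sup>*}"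
  have "r \<in> ?V" using r by (simp add: heavy_def girg_verts_def)
  obtain f where f: "heavy J k (f k)" if "k \<in> good" for k
    using ex_heavy[of _ J] by (auto simp: anc_def) metis
  \<comment> \<open>Distinct cells of depth \<open>J\<close> are disjoint, so the vertices chosen in
    them differ.\<close>
  have "inj_on f good"
  proof (rule inj_onI)
    fix k l assume "k \<in> good" "l \<in> good" "f k = f l"
    then show "k = l" using f[of k] f[of l] dyadic_cell_disjoint[of k l J] by (auto simp: heavy_def)
  qed
  moreover have "f ` good \<subseteq> R `` {r}"
    using f conn[of _ J] \<open>r \<in> ?V\<close> by (auto simp: R_def anc_def heavy_def girg_verts_def)
  moreover have "finite (R `` {r})"
    by (rule finite_subset[of _ ?V]) (auto simp: R_def girg_verts_def)
  ultimately have "card good \<le> card (R `` {r})"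
    by (metis card_image card_mono)
  with good have "2 ^ (J * CARD('d)) \<le> card (R `` {r}) + S" by simp
  moreover have "R `` {r} \<in> graph_components ?V ?E"
    unfolding graph_components_def R_def[symmetric] using \<open>r \<in> ?V\<close> by (rule quotientI)
  ultimately show ?thesis unfolding S_def B_def by blast
qed

subsection \<open>Union bound over the light cells\<close>

context threshold_girg
begin

text \<open>Union bound over all sets \<open>T\<close> of at least \<open>s\<close> cells. All cells
  of \<open>T\<close> are light exactly when their union contains no heavy vertex, so one void
  probability treats the whole set. The number of sets is at most
  \<open>2 ^ 2 ^ (j * CARD('d))\<close>.\<close>

lemma prob_many_light_cells:
  assumes "1 \<le> w"
  shows "{\<omega> \<in> space M. s \<le> real (card (light_cells N X W w j \<omega>))} \<in> events" (is "?E \<in> _")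
    and "prob {\<omega> \<in> space M. s \<le> real (card (light_cells N X W w j \<omega>))} \<le>
      2 ^ 2 ^ (j * CARD('d)) * exp (- (n * (1 / 2 ^ j) ^ CARD('d) * w powr (- (\<tau> - 1)) * s))"
proof -
  define \<T> where "\<T> = {T. T \<subseteq> (dyadic_indices j :: ('d \<Rightarrow> int) set) \<and> s \<le> real (card T)}"
  define F where "F T = {\<omega> \<in> space M. \<forall>i<N \<omega>. X i \<omega> \<in> (\<Union>k\<in>T. dyadic_cell j k) \<longrightarrow> W i \<omega> \<le> w}" for T
  have sub: "\<T> \<subseteq> Pow (dyadic_indices j)" by (auto simp: \<T>_def)
  hence fin: "finite \<T>" by (rule finite_subset) simp
  have finT: "finite T" if "T \<in> \<T>" for T
    using that by (auto simp: \<T>_def intro: finite_subset[OF _ finite_dyadic_indices])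
  have cells: "(\<Union>k\<in>T. dyadic_cell j k) \<in> sets borel" if "T \<in> \<T>" for T
    using finT[OF that] by auto
  have F: "F T \<in> events" if "T \<in> \<T>" for T
    unfolding F_def using cells[OF that] by (rule light_event)
  have E: "?E = (\<Union>T\<in>\<T>. F T)"
  proof (intro equalityI subsetI)
    fix \<omega> assume "\<omega> \<in> ?E"
    then show "\<omega> \<in> (\<Union>T\<in>\<T>. F T)"
      by (intro UN_I[of "light_cells N X W w j \<omega>"]) (auto simp: \<T>_def F_def light_cells_def)
  next
    fix \<omega> assume "\<omega> \<in> (\<Union>T\<in>\<T>. F T)"
    then obtain T where T: "T \<in> \<T>" "\<omega> \<in> F T" by blast
    hence "T \<subseteq> light_cells N X W w j \<omega>" by (auto simp: \<T>_def F_def light_cells_def)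
    hence "card T \<le> card (light_cells N X W w j \<omega>)"
      by (rule card_mono[rotated]) (simp add: light_cells_def)
    with T show "\<omega> \<in> ?E" by (auto simp: \<T>_def F_def)
  qed
  show "?E \<in> events" unfolding E using fin F by auto
  have "prob (F T) \<le> exp (- (n * (1 / 2 ^ j) ^ CARD('d) * w powr (- (\<tau> - 1)) * s))"
    if T: "T \<in> \<T>" for T
  proof -
    have "prob (F T) = exp (- (n * measure lborel (\<Union>k\<in>T. dyadic_cell j k) * w powr (- (\<tau> - 1))))"
      unfolding F_def using cells[OF T] T assms dyadic_cell_subset_cbox
      by (intro prob_no_heavy_point) (fastforce simp: \<T>_def)+
    moreover have "s * (1 / 2 ^ j) ^ CARD('d) \<le> measure lborel (\<Union>k\<in>T. dyadic_cell j k)"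
    proof -
      have "s * (1 / 2 ^ j) ^ CARD('d) \<le> real (card T) * (1 / 2 ^ j) ^ CARD('d)"
        using T by (intro mult_right_mono) (auto simp: \<T>_def)
      also have "\<dots> \<le> measure lborel (\<Union>k\<in>T. dyadic_cell j k)"
        using T by (intro measure_Union_dyadic_cell_ge) (auto simp: \<T>_def)
      finally show ?thesis .
    qed
    hence "n * (s * (1 / 2 ^ j) ^ CARD('d)) * w powr (- (\<tau> - 1)) \<le>
        n * measure lborel (\<Union>k\<in>T. dyadic_cell j k) * w powr (- (\<tau> - 1))"
      using intensity_pos by (intro mult_right_mono mult_left_mono) auto
    ultimately show ?thesis by (simp only: exp_le_cancel_iff neg_le_iff_le mult_ac)
  qed
  hence "(\<Sum>T\<in>\<T>. prob (F T)) \<le> of_nat (card \<T>) * exp (- (n * (1 / 2 ^ j) ^ CARD('d) * w powr (- (\<tau> - 1)) * s))"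
    by (rule sum_bounded_above)
  also have "\<dots> \<le> 2 ^ 2 ^ (j * CARD('d)) * exp (- (n * (1 / 2 ^ j) ^ CARD('d) * w powr (- (\<tau> - 1)) * s))"
  proof (intro mult_right_mono)
    have "card \<T> \<le> card (Pow (dyadic_indices j :: ('d \<Rightarrow> int) set))"
      using sub by (intro card_mono) auto
    also have "\<dots> = 2 ^ 2 ^ (j * CARD('d))" by (simp add: card_Pow card_dyadic_indices)
    finally have "real (card \<T>) \<le> real (2 ^ 2 ^ (j * CARD('d)))" by (simp only: of_nat_le_iff)
    then show "real (card \<T>) \<le> 2 ^ 2 ^ (j * CARD('d))" by simp
  qed simp
  finally show "prob ?E \<le> 2 ^ 2 ^ (j * CARD('d)) * exp (- (n * (1 / 2 ^ j) ^ CARD('d) * w powr (- (\<tau> - 1)) * s))"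
    using finite_measure_subadditive_finite[OF fin, of F] F unfolding E by (force simp: image_subset_iff)
qed

text \<open>By assumption \<open>J\<close> the deepest cells contain at least \<open>m\<close>
  vertices on average. The bound \<open>lam \<le> m\<close> makes all weight thresholds at least 1,
  where the tail formula applies, and assumption \<open>m\<close> makes the exponent per cell at
  least 2, which beats the number of sets of cells.\<close>

lemma prob_linear_component:
  fixes lam m :: real and J :: nat
  defines "\<kappa> \<equiv> (3 - \<tau>) / 2"
  defines "\<rho> \<equiv> 2 powr (- (real CARD('d) * \<kappa>))"
  defines "\<epsilon> \<equiv> (1 - \<rho>) / 4"
  defines "c \<equiv> (2 ^ CARD('d) / lam) powr (- ((\<tau> - 1) / 2))"
  assumes \<tau>: "2 < \<tau>" "\<tau> < 3" and lam: "0 < lam" "lam \<le> m"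
    and m: "2 \<le> \<epsilon> * c * m powr \<kappa>" and J: "m * 2 ^ (J * CARD('d)) \<le> n"
  shows "prob {\<omega> \<in> space M. \<exists>K\<in>graph_components (girg_verts N \<omega>) (girg_edges N X n W lam \<omega>).
      2 ^ (J * CARD('d)) / 2 \<le> real (card K) \<and> real (card K) \<le> 3 * n}
    \<ge> 1 - (real (Suc J) * exp (- (\<epsilon> * c / 2 * n powr \<kappa>)) + exp (- n))"
proof -
  let ?d = "CARD('d)"
  define \<mu> where "\<mu> j = n * (1 / 2 ^ j) ^ ?d" for j :: nat
  \<comment> \<open>The factor \<open>2 ^ ?d\<close> compensates for the smaller cells one level
    down: \<open>w (Suc j)\<close> is still \<open>sqrt (\<mu> j / lam)\<close>, so heavy vertices
    of consecutive depths are adjacent within a cell of depth \<open>j\<close>.\<close>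
  define w where "w j = sqrt (2 ^ ?d * \<mu> j / lam)" for j
  define e where "e j = \<epsilon> * (\<rho> ^ j + \<rho> ^ (J - j))" for j
  have n: "0 < n" by (rule intensity_pos)
  have \<kappa>: "0 < \<kappa>" using \<tau> by (simp add: \<kappa>_def)
  have \<mu>_pos: "0 < \<mu> j" for j using n by (simp add: \<mu>_def)
  have c: "0 < c" using lam by (simp add: c_def)
  have \<rho>: "0 < \<rho>" "\<rho> < 1" using \<kappa> by (simp_all add: \<rho>_def powr_less_one)
  have \<epsilon>: "0 < \<epsilon>" using \<rho> by (simp add: \<epsilon>_def)
  have \<mu>_powr: "\<mu> j powr \<kappa> = n powr \<kappa> * \<rho> ^ j" for j
  proof -
    have "(1 / 2 ^ j) ^ ?d = 2 powr (- (real j * real ?d))"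
      by (simp add: powr_minus powr_realpow power_mult field_simps flip: of_nat_mult)
    hence "\<mu> j powr \<kappa> = n powr \<kappa> * 2 powr (- (real j * real ?d) * \<kappa>)"
      using n by (simp add: \<mu>_def powr_mult powr_powr)
    also have "2 powr (- (real j * real ?d) * \<kappa>) = \<rho> ^ j"
      by (simp add: \<rho>_def powr_powr mult_ac flip: powr_realpow)
    finally show ?thesis .
  qed
  have \<mu>_ge: "m \<le> \<mu> j" if "j \<le> J" for j
  proof -
    have "m \<le> n * (1 / 2 ^ J) ^ ?d"
      using J by (simp add: field_simps power_mult)
    also have "\<dots> \<le> \<mu> j"
      unfolding \<mu>_def using n that by (intro mult_left_mono power_mono divide_left_mono power_increasing) auto
    finally show ?thesis .
  qed
  have w_ge: "sqrt (\<mu> j / lam) \<le> w j" for j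
    unfolding w_def using lam \<mu>_pos[of j]
    by (intro real_sqrt_le_mono divide_right_mono) (auto simp: mult_le_cancel_right1)
  have w_nonneg: "0 \<le> w j" for j
    using lam \<mu>_pos[of j] by (simp add: w_def)
  have w_Suc: "w (Suc j) = sqrt (\<mu> j / lam)" for j
    by (simp add: w_def \<mu>_def power_divide power_mult_distrib)
  have ww: "\<mu> j \<le> lam * w j * v" if "sqrt (\<mu> j / lam) \<le> v" for j v
  proof -
    have "\<mu> j = lam * (sqrt (\<mu> j / lam) * sqrt (\<mu> j / lam))" using lam \<mu>_pos[of j] by simp
    also have "\<dots> \<le> lam * (w j * v)"
      using lam w_ge[of j] that \<mu>_pos[of j] w_nonneg[of j] by (intro mult_left_mono mult_mono) auto
    finally show ?thesis by simp
  qed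
  have w_ge_1: "1 \<le> w j" if "j \<le> J" for j
  proof -
    have "1 \<le> sqrt (\<mu> j / lam)" using lam \<mu>_ge[OF that] by simp
    with w_ge[of j] show ?thesis by linarith
  qed
  \<comment> \<open>The mean number of heavy vertices in a cell of volume
    \<open>(1 / 2 ^ j) ^ ?d\<close>; the exponent is
    \<open>1 - (\<tau> - 1) / 2 = \<kappa>\<close>.\<close>
  have rate: "\<mu> j * w j powr (- (\<tau> - 1)) = c * n powr \<kappa> * \<rho> ^ j" for j
  proof -
    have "w j = (2 ^ ?d / lam * \<mu> j) powr (1 / 2)"
      using lam \<mu>_pos[of j] by (simp add: w_def powr_half_sqrt)
    hence "w j powr (- (\<tau> - 1)) = (2 ^ ?d / lam * \<mu> j) powr (1 / 2 * (- (\<tau> - 1)))"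
      by (simp only: powr_powr)
    also have "1 / 2 * (- (\<tau> - 1)) = - ((\<tau> - 1) / 2)" by (simp add: field_simps)
    also have "(2 ^ ?d / lam * \<mu> j) powr \<dots> = c * \<mu> j powr \<dots>"
      unfolding c_def using lam \<mu>_pos[of j] by (intro powr_mult)
    finally have "w j powr (- (\<tau> - 1)) = c * \<mu> j powr (- ((\<tau> - 1) / 2))" .
    hence "\<mu> j * w j powr (- (\<tau> - 1)) = c * (\<mu> j powr 1 * \<mu> j powr (- ((\<tau> - 1) / 2)))"
      using \<mu>_pos[of j] by simp
    also have "\<mu> j powr 1 * \<mu> j powr (- ((\<tau> - 1) / 2)) = \<mu> j powr \<kappa>"
      unfolding powr_add[symmetric] by (simp add: \<kappa>_def field_simps)
    finally show ?thesis by (simp add: \<mu>_powr)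
  qed

  define Ev where "Ev j = {\<omega> \<in> space M. e j * 2 ^ (j * ?d) \<le> real (card (light_cells N X W (w j) j \<omega>))}" for j
  have Ev: "Ev j \<in> events" if "j \<le> J" for j
    unfolding Ev_def by (rule prob_many_light_cells(1)[OF w_ge_1[OF that]])
  have prob_Ev: "prob (Ev j) \<le> exp (- (\<epsilon> * c / 2 * n powr \<kappa>))" if j: "j \<le> J" for j
  proof -
    define D :: real where "D = 2 ^ (j * ?d)"
    define y where "y = c * n powr \<kappa> * \<rho> ^ j * e j"
    have "2 \<le> \<epsilon> * c * m powr \<kappa>" by (rule m)
    also have "\<dots> \<le> \<epsilon> * c * \<mu> J powr \<kappa>"
      using \<epsilon> c lam \<kappa> \<mu>_ge[of J] by (intro mult_left_mono powr_mono2) auto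
    \<comment> \<open>Here the second summand of \<open>e j\<close> is used:
      \<open>\<rho> ^ j * \<rho> ^ (J - j) = \<rho> ^ J\<close>, so the bound is the same at every
      depth.\<close>
    also have "\<dots> = c * n powr \<kappa> * \<rho> ^ j * (\<epsilon> * \<rho> ^ (J - j))"
      using j by (simp add: \<mu>_powr flip: power_add)
    also have "\<dots> \<le> y"
      unfolding y_def e_def using \<epsilon> c \<rho> by (intro mult_left_mono) auto
    finally have y: "2 \<le> y" .
    \<comment> \<open>Now the first summand of \<open>e j\<close>. Since
      \<open>1 - 2 * \<kappa> = \<tau> - 2\<close>, this is where \<open>2 < \<tau>\<close>
      enters.\<close>
    have "1 \<le> 2 powr (real ?d * (1 - 2 * \<kappa>))"
      using \<tau> by (intro ge_one_powr_ge_zero) (auto simp: \<kappa>_def)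
    also have "\<dots> = 2 powr (real ?d) * (\<rho> * \<rho>)"
      unfolding \<rho>_def powr_add[symmetric] by (simp add: algebra_simps)
    finally have "1 \<le> (2 powr (real ?d) * (\<rho> * \<rho>)) ^ j" by (rule one_le_power)
    also have "\<dots> = \<rho> ^ j * \<rho> ^ j * D"
      by (simp add: D_def power_mult_distrib powr_realpow mult.commute[of j] power_mult)
    finally have "\<epsilon> * c * n powr \<kappa> * 1 \<le> \<epsilon> * c * n powr \<kappa> * (\<rho> ^ j * \<rho> ^ j * D)"
      using \<epsilon> c by (intro mult_left_mono) auto
    also have "\<dots> = c * n powr \<kappa> * \<rho> ^ j * (\<epsilon> * \<rho> ^ j) * D" by (simp only: mult_ac)
    also have "\<dots> \<le> y * D"
      unfolding y_def e_def D_def using \<epsilon> c \<rho> by (intro mult_right_mono mult_left_mono) auto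
    finally have yD: "\<epsilon> * c * n powr \<kappa> \<le> y * D" by simp
    have "prob (Ev j) \<le> 2 ^ 2 ^ (j * ?d) * exp (- (\<mu> j * w j powr (- (\<tau> - 1)) * (e j * D)))"
      unfolding Ev_def \<mu>_def D_def by (rule prob_many_light_cells(2)[OF w_ge_1[OF j]])
    also have "\<dots> = 2 ^ 2 ^ (j * ?d) * exp (- (y * D))"
      unfolding rate y_def by (simp only: mult_ac)
    also have "\<dots> \<le> exp D * exp (- (y * D))"
    proof (intro mult_right_mono)
      have "(2::real) ^ 2 ^ (j * ?d) \<le> exp 1 ^ 2 ^ (j * ?d)"
        using exp_ge_add_one_self[of 1] by (intro power_mono) auto
      also have "\<dots> = exp D" by (simp add: D_def flip: exp_of_nat_mult)
      finally show "2 ^ 2 ^ (j * ?d) \<le> exp D" .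
    qed simp
    also have "\<dots> = exp (D - y * D)" by (simp flip: exp_add)
    also have "\<dots> \<le> exp (- (\<epsilon> * c / 2 * n powr \<kappa>))"
    proof -
      \<comment> \<open>Hence \<open>D - y * D\<close> is at most \<open>- (y * D) / 2\<close>: half
        of the exponent pays for the number of sets.\<close>
      have "2 * D \<le> y * D" using y by (intro mult_right_mono) (auto simp: D_def)
      with yD show ?thesis by simp
    qed
    finally show ?thesis .
  qed

  define Good where "Good = {\<omega> \<in> space M.
    \<exists>K\<in>graph_components (girg_verts N \<omega>) (girg_edges N X n W lam \<omega>).
      2 ^ (J * ?d) / 2 \<le> real (card K) \<and> real (card K) \<le> 3 * n}"
  define Big where "Big = {\<omega> \<in> space M. 3 * n < real (N \<omega>)}"
  have Good: "Good \<in> events" unfolding Good_def by (rule girg_property_event)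
  have Big: "Big \<in> events" unfolding Big_def by measurable
  \<comment> \<open>Each of the two geometric sums is at most \<open>1 / (1 - \<rho>)\<close>; the 4
    in \<open>\<epsilon>\<close> is chosen to make the total at most 1/2.\<close>
  have sum_e: "(\<Sum>j\<le>J. e j) \<le> 1 / 2"
  proof -
    have "(\<Sum>j\<le>J. \<rho> ^ (J - j)) = (\<Sum>j\<le>J. \<rho> ^ j)"
      by (rule sum.reindex_bij_witness[of _ "\<lambda>j. J - j" "\<lambda>j. J - j"]) auto
    hence "(\<Sum>j\<le>J. e j) = \<epsilon> * (2 * (\<Sum>j\<le>J. \<rho> ^ j))"
      by (simp add: e_def sum.distrib flip: sum_distrib_left)
    also have "(\<Sum>j\<le>J. \<rho> ^ j) = (1 - \<rho> ^ Suc J) / (1 - \<rho>)"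
      using \<rho> by (simp add: sum_gp0)
    also have "\<epsilon> * (2 * ((1 - \<rho> ^ Suc J) / (1 - \<rho>))) = (1 - \<rho> ^ Suc J) / 2"
      using \<rho> by (simp add: \<epsilon>_def field_simps)
    finally show ?thesis using \<rho> by simp
  qed
  have "space M - Good \<subseteq> (\<Union>j\<le>J. Ev j) \<union> Big"
  proof (rule ccontr)
    assume "\<not> ?thesis"
    then obtain \<omega> where \<omega>: "\<omega> \<in> space M" "\<omega> \<notin> Good" "\<And>j. j \<le> J \<Longrightarrow> \<omega> \<notin> Ev j" "\<omega> \<notin> Big"
      by blast
    define S where "S = (\<Sum>j\<le>J. card (light_cells N X W (w j) j \<omega>) * 2 ^ ((J - j) * ?d))"
    have "real S = (\<Sum>j\<le>J. real (card (light_cells N X W (w j) j \<omega>)) * 2 ^ ((J - j) * ?d))"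
      by (simp add: S_def)
    also have "\<dots> \<le> (\<Sum>j\<le>J. e j * 2 ^ (J * ?d))"
    \<comment> \<open>A fraction \<open>e j\<close> of light cells at depth \<open>j\<close> spoils
      at most the same fraction of the cells of depth \<open>J\<close>.\<close>
    proof (rule sum_mono)
      fix j assume j: "j \<in> {..J}"
      have "real (card (light_cells N X W (w j) j \<omega>)) * 2 ^ ((J - j) * ?d) \<le>
          (e j * 2 ^ (j * ?d)) * 2 ^ ((J - j) * ?d)"
        using \<omega>(1,3) j by (intro mult_right_mono) (auto simp: Ev_def not_le less_imp_le)
      also have "\<dots> = e j * 2 ^ (J * ?d)"
        using j by (simp flip: power_add add_mult_distrib)
      finally show "real (card (light_cells N X W (w j) j \<omega>)) * 2 ^ ((J - j) * ?d) \<le> e j * 2 ^ (J * ?d)" .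
    qed
    also have "\<dots> \<le> 1 / 2 * 2 ^ (J * ?d)"
      unfolding sum_distrib_right[symmetric] using sum_e by (intro mult_right_mono) auto
    finally have S: "real S \<le> 2 ^ (J * ?d) / 2" by simp
    also have "\<dots> < real (2 ^ (J * ?d))" by simp
    finally have "S < 2 ^ (J * ?d)" by (simp only: of_nat_less_iff)
    then obtain K where K: "K \<in> graph_components (girg_verts N \<omega>) (girg_edges N X n W lam \<omega>)"
      "2 ^ (J * ?d) \<le> card K + S"
      using component_through_heavy_cells[OF n lam(1) w_nonneg
          ww[OF w_ge, unfolded \<mu>_def] ww[OF eq_refl[OF w_Suc[symmetric]], unfolded \<mu>_def],
          where J = J and N = N and X = X and W = W and \<omega> = \<omega>]
      unfolding S_def by blast
    have "real (2 ^ (J * ?d)) \<le> real (card K + S)" using K(2) by (simp only: of_nat_le_iff)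
    hence "2 ^ (J * ?d) / 2 \<le> real (card K)" using S by simp
    moreover have "card K \<le> N \<omega>"
    proof -
      have "K \<subseteq> {..<N \<omega>}"
        using K(1) by (auto simp: graph_components_def quotient_def girg_verts_def)
      from card_mono[OF _ this] show ?thesis by simp
    qed
    hence "real (card K) \<le> 3 * n" using \<omega>(1,4) by (auto simp: Big_def)
    ultimately show False using K(1) \<omega>(1,2) by (auto simp: Good_def)
  qed
  hence "1 - prob Good \<le> prob ((\<Union>j\<le>J. Ev j) \<union> Big)"
    using Ev Big by (subst prob_compl[OF Good, symmetric]) (intro finite_measure_mono, auto)
  also have "\<dots> \<le> prob (\<Union>j\<le>J. Ev j) + prob Big"
    using Ev Big by (intro measure_Un_le) auto
  also have "\<dots> \<le> (\<Sum>j\<le>J. prob (Ev j)) + exp (- n)"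
    using Ev prob_number_gt unfolding Big_def
    by (intro add_mono finite_measure_subadditive_finite) auto
  also have "(\<Sum>j\<le>J. prob (Ev j)) \<le> real (Suc J) * exp (- (\<epsilon> * c / 2 * n powr \<kappa>))"
    using sum_bounded_above[of "{..J}" "\<lambda>j. prob (Ev j)"] prob_Ev by simp
  finally show ?thesis by (simp add: Good_def)
qed

end

section \<open>Choice of the depth and the constants\<close>

lemma ex_dyadic_scale:
  fixes m n :: real
  assumes "0 < m" "m \<le> n" "0 < d"
  shows "\<exists>J. m * 2 ^ (J * d) \<le> n \<and> n < m * 2 ^ (Suc J * d)"
proof -
  have "\<exists>J. n / m < (2 ^ d) ^ J"
    using assms by (intro real_arch_pow) simp
  hence ex: "\<exists>J. n < m * 2 ^ (J * d)"
    using assms by (simp add: field_simps power_mult[symmetric] mult.commute)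
  \<comment> \<open>The first scale that overshoots \<open>n\<close>; it is not 0 because
    \<open>m \<le> n\<close>, so its predecessor is the required depth.\<close>
  define L where "L = (LEAST J. n < m * 2 ^ (J * d))"
  have L: "n < m * 2 ^ (L * d)" unfolding L_def using ex by (rule LeastI_ex)
  then obtain J where J: "L = Suc J" using assms by (cases L) auto
  have "\<not> n < m * 2 ^ (J * d)" using J by (intro not_less_Least) (simp add: L_def)
  with L J show ?thesis by (intro exI[of _ J]) simp
qed

theorem theorem3p4:
  fixes \<tau> lam :: real
  assumes "2 < \<tau>" and "\<tau> < 3" and "0 < lam"
  shows "\<exists>c C b :: real. 0 < c \<and> 0 < C \<and> 0 < b \<and>
    (\<forall>\<^sub>F n :: real in at_top.
      \<forall>(M :: 'w measure) (N :: 'w \<Rightarrow> nat) (X :: nat \<Rightarrow> 'w \<Rightarrow> real ^ 'd) (W :: nat \<Rightarrow> 'w \<Rightarrow> real).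
        threshold_girg M N X n W \<tau> \<longrightarrow>
        measure M {\<omega> \<in> space M.
            \<exists>K \<in> graph_components (girg_verts N \<omega>) (girg_edges N X n W lam \<omega>).
              c * n \<le> real (card K) \<and> real (card K) \<le> C * n}
          \<ge> 1 - exp (- (b * n powr ((3 - \<tau>) / 2))))"
proof -
  let ?d = "CARD('d)"
  define \<kappa> where "\<kappa> = (3 - \<tau>) / 2"
  define \<rho> where "\<rho> = 2 powr (- (real ?d * \<kappa>))"
  define \<epsilon> where "\<epsilon> = (1 - \<rho>) / 4"
  define c where "c = (2 ^ ?d / lam) powr (- ((\<tau> - 1) / 2))"
  define b where "b = \<epsilon> * c / 2"
  \<comment> \<open>The value 1 yields \<open>Suc J \<le> n\<close> below, \<open>lam\<close> keeps
    the weight thresholds at least 1, and the last term solves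
    \<open>2 \<le> \<epsilon> * c * m powr \<kappa>\<close>.\<close>
  define m where "m = max 1 (max lam ((2 / (\<epsilon> * c)) powr (1 / \<kappa>)))"
  have \<kappa>: "0 < \<kappa>" "\<kappa> < 1" using assms by (simp_all add: \<kappa>_def)
  have "\<rho> < 1" using \<kappa> by (simp add: \<rho>_def powr_less_one)
  hence \<epsilon>: "0 < \<epsilon>" by (simp add: \<epsilon>_def)
  have c: "0 < c" using assms by (simp add: c_def)
  have b: "0 < b" using \<epsilon> c by (simp add: b_def)
  have m1: "1 \<le> m" "lam \<le> m" by (simp_all add: m_def)
  have "2 / (\<epsilon> * c) = ((2 / (\<epsilon> * c)) powr (1 / \<kappa>)) powr \<kappa>"
    using \<kappa> \<epsilon> c by (simp add: powr_powr)
  also have "\<dots> \<le> m powr \<kappa>" using \<kappa> by (intro powr_mono2) (auto simp: m_def)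
  finally have m: "2 \<le> \<epsilon> * c * m powr \<kappa>" using \<epsilon> c by (simp add: field_simps)
  \<comment> \<open>Halving the exponent absorbs the number of depths, at most \<open>n\<close>, and
    the term \<open>exp (- n)\<close>, which is of smaller order as
    \<open>\<kappa> < 1\<close>.\<close>
  have "\<forall>\<^sub>F n in at_top. n * exp (- (b * n powr \<kappa>)) + exp (- n) \<le> exp (- (b / 2 * n powr \<kappa>))"
    using b \<kappa> by real_asymp
  moreover have "\<forall>\<^sub>F n in at_top. m \<le> n" by (rule eventually_ge_at_top)
  ultimately have "\<forall>\<^sub>F n :: real in at_top.
      \<forall>(M :: 'w measure) (N :: 'w \<Rightarrow> nat) (X :: nat \<Rightarrow> 'w \<Rightarrow> real ^ 'd) (W :: nat \<Rightarrow> 'w \<Rightarrow> real).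
        threshold_girg M N X n W \<tau> \<longrightarrow>
        measure M {\<omega> \<in> space M.
            \<exists>K \<in> graph_components (girg_verts N \<omega>) (girg_edges N X n W lam \<omega>).
              1 / (2 * m * 2 ^ ?d) * n \<le> real (card K) \<and> real (card K) \<le> 3 * n}
          \<ge> 1 - exp (- (b / 2 * n powr \<kappa>))"
  proof eventually_elim
    case (elim n)
    show ?case
    proof (intro allI impI)
      fix M :: "'w measure" and N X and W :: "nat \<Rightarrow> 'w \<Rightarrow> real"
      assume "threshold_girg M N (X :: nat \<Rightarrow> 'w \<Rightarrow> real ^ 'd) n W \<tau>"
      then interpret threshold_girg M N X n W \<tau> .
      obtain J where J: "m * 2 ^ (J * ?d) \<le> n" "n < m * 2 ^ (Suc J * ?d)"
        using ex_dyadic_scale[of m n ?d] m1 elim(2) by auto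
      have "Suc J \<le> 2 ^ J" by (simp add: Suc_le_eq)
      hence "real (Suc J) \<le> 2 ^ J" by (metis of_nat_le_iff of_nat_numeral of_nat_power)
      also have "\<dots> \<le> 2 ^ (J * ?d)" by (intro power_increasing) auto
      also have "\<dots> \<le> m * 2 ^ (J * ?d)" using m1 by simp
      also note J(1)
      finally have Jn: "real (Suc J) \<le> n" .
      \<comment> \<open>By maximality of \<open>J\<close>, the number of deepest cells exceeds
        \<open>n / (m * 2 ^ ?d)\<close>; half of them give the linear lower bound.\<close>
      have cn: "1 / (2 * m * 2 ^ ?d) * n \<le> 2 ^ (J * ?d) / 2"
        using J(2) m1 by (simp add: field_simps power_add)
      have "1 - exp (- (b / 2 * n powr \<kappa>)) \<le> 1 - (n * exp (- (b * n powr \<kappa>)) + exp (- n))"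
        using elim(1) by simp
      also have "\<dots> \<le> 1 - (real (Suc J) * exp (- (b * n powr \<kappa>)) + exp (- n))"
        using mult_right_mono[OF Jn, of "exp (- (b * n powr \<kappa>))"] by simp
      also have "\<dots> \<le> prob {\<omega> \<in> space M.
          \<exists>K\<in>graph_components (girg_verts N \<omega>) (girg_edges N X n W lam \<omega>).
            2 ^ (J * ?d) / 2 \<le> real (card K) \<and> real (card K) \<le> 3 * n}"
        by (rule prob_linear_component[where lam = lam, folded \<kappa>_def, folded \<rho>_def, folded \<epsilon>_def c_def,
            folded b_def, OF assms m1(2) m J(1)])
      also have "\<dots> \<le> prob {\<omega> \<in> space M.
          \<exists>K\<in>graph_components (girg_verts N \<omega>) (girg_edges N X n W lam \<omega>).
            1 / (2 * m * 2 ^ ?d) * n \<le> real (card K) \<and> real (card K) \<le> 3 * n}"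
        using order.trans[OF cn] by (intro finite_measure_mono girg_property_event) blast
      finally show "1 - exp (- (b / 2 * n powr \<kappa>)) \<le> prob {\<omega> \<in> space M.
          \<exists>K\<in>graph_components (girg_verts N \<omega>) (girg_edges N X n W lam \<omega>).
            1 / (2 * m * 2 ^ ?d) * n \<le> real (card K) \<and> real (card K) \<le> 3 * n}" .
    qed
  qed
  then show ?thesis
    using b m1 unfolding \<kappa>_def
    by (intro exI[of _ "1 / (2 * m * 2 ^ ?d)"] exI[of _ 3] exI[of _ "b / 2"]) simp
qed

end
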